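(* Let $\mathbb{F}$ be a field and let $P$ be a syntactic multilinear ABP of size $S$ computing a polynomial $f\in\mathbb{F}[x_1,\ldots,x_n]$. Then there exists a syntactic multilinear $\Sigma\Pi^{[\sqrt n]}(\Sigma\Pi)^{[\sqrt n]}$ formula of size $2^{O(\sqrt n\,\log n\,\log S)}$ computing $f$.
   Context: Let $X=\{x_1,\ldots,x_n\}$. An algebraic branching program (ABP) over $\mathbb{F}$ is a directed acyclic graph whose vertices are partitioned into layers $L_0,\ldots,L_\ell$, with edges going only from $L_i$ to $L_{i+1}$; $L_0=\{s\}$ (source, the one vertex of in-degree 0) and $L_\ell=\{t\}$ (sink, the one vertex of out-degree 0). Each edge is labeled by an element of $X\cup\mathbb{F}$. The size is the number of nodes. The polynomial computed is the sum over all $s$-to-$t$ paths of the product of the edge labels. The ABP is syntactic multilinear if every variable occurs at most once on every $s$-to-$t$ path. A $\Sigma\Pi^{[\sqrt n]}(\Sigma\Pi)^{[\sqrt n]}$ formula is a depth-four arithmetic formula (unbounded fan-in, alternating layers of $+$ and $\times$ gates, with a $+$ gate on top) computing an expression $\sum_{i=1}^{T}\prod_{j=1}^{d_i}Q_{ij}$, where each $d_i=O(\sqrt n)$ and each $Q_{ij}$ is a multilinear polynomial in $O(\sqrt n)$ variables, given as a sum of monomials. It is syntactic multilinear if the children of every product gate depend on pairwise disjoint sets of variables. The size of a formula is its number of gates. The constants hidden in $O(\cdot)$ are absolute. *)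

theory Defs
  imports
    Complex_Main
    "HOL-Library.Poly_Mapping"
    "HOL-Library.Disjoint_Sets"
    "Graph_Theory.Digraph"
    "Graph_Theory.Arc_Walk"
begin

section \<open>Multivariate polynomials\<close>

text \<open>
  A monomial is a finitely supported exponent vector, a polynomial a finitely supported map from
  monomials to coefficients; the variable \<open>x\<^sub>i\<close> is the number \<open>i\<close>.
\<close>

type_synonym 'a mpoly = "(nat \<Rightarrow>\<^sub>0 nat) \<Rightarrow>\<^sub>0 'a"

definition multilinear :: "'a::zero mpoly \<Rightarrow> bool" where
  "multilinear p \<longleftrightarrow>
     (\<forall>m \<in> Poly_Mapping.keys p. \<forall>i. Poly_Mapping.lookup m i \<le> 1)"

datatype 'a atom = Variable nat | Constant 'a

fun atom_poly :: "'a::comm_ring_1 atom \<Rightarrow> 'a mpoly" where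
  "atom_poly (Variable i) = Poly_Mapping.single (Poly_Mapping.single i 1) 1"
| "atom_poly (Constant a) = Poly_Mapping.single 0 a"

fun atom_vars :: "'a atom \<Rightarrow> nat set" where
  "atom_vars (Variable i) = {i}"
| "atom_vars (Constant a) = {}"


section \<open>Algebraic branching programs\<close>

record ('v, 'e, 'a) abp =
  graph :: "('v, 'e) pre_digraph"
  label :: "'e \<Rightarrow> 'a atom"
  source :: 'v
  sink :: 'v

text \<open>
  Parallel arcs are allowed; programs on a simple directed graph are a special case. Acyclicity
  is a consequence of the layering.
\<close>

definition is_abp :: "nat \<Rightarrow> ('v, 'e, 'a) abp \<Rightarrow> bool" where
  "is_abp n P \<longleftrightarrow>
     fin_digraph (graph P) \<and>
     (\<exists>l L. verts (graph P) = (\<Union>i\<le>l. L i) \<and> disjoint_family_on L {..l} \<and>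
        L 0 = {source P} \<and> L l = {sink P} \<and>
        (\<forall>e \<in> arcs (graph P). \<exists>i<l. tail (graph P) e \<in> L i \<and> head (graph P) e \<in> L (Suc i))) \<and>
     {v \<in> verts (graph P). in_degree (graph P) v = 0} = {source P} \<and>
     {v \<in> verts (graph P). out_degree (graph P) v = 0} = {sink P} \<and>
     (\<forall>e \<in> arcs (graph P). atom_vars (label P e) \<subseteq> {1..n})"

definition abp_paths :: "('v, 'e, 'a) abp \<Rightarrow> 'e list set" where
  "abp_paths P = {p. pre_digraph.apath (graph P) (source P) p (sink P)}"

text \<open>The sum is over a finite set by \<open>fin_digraph.apaths_finite\<close>.\<close>

definition abp_poly :: "('v, 'e, 'a::comm_ring_1) abp \<Rightarrow> 'a mpoly" where
  "abp_poly P = (\<Sum>p \<in> abp_paths P. prod_list (map (\<lambda>e. atom_poly (label P e)) p))"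

definition abp_size :: "('v, 'e, 'a) abp \<Rightarrow> nat" where
  "abp_size P = card (verts (graph P))"

definition abp_syntactic_multilinear :: "('v, 'e, 'a) abp \<Rightarrow> bool" where
  "abp_syntactic_multilinear P \<longleftrightarrow>
     (\<forall>p \<in> abp_paths P. \<forall>i. count_list (map (label P) p) (Variable i) \<le> 1)"


section \<open>Arithmetic formulas\<close>

datatype 'a formula = Leaf "'a atom" | Plus "'a formula list" | Times "'a formula list"

fun formula_poly :: "'a::comm_ring_1 formula \<Rightarrow> 'a mpoly" where
  "formula_poly (Leaf a) = atom_poly a"
| "formula_poly (Plus Fs) = sum_list (map formula_poly Fs)"
| "formula_poly (Times Fs) = prod_list (map formula_poly Fs)"

fun formula_vars :: "'a formula \<Rightarrow> nat set" where
  "formula_vars (Leaf a) = atom_vars a"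
| "formula_vars (Plus Fs) = (\<Union>F \<in> set Fs. formula_vars F)"
| "formula_vars (Times Fs) = (\<Union>F \<in> set Fs. formula_vars F)"

text \<open>Input gates are counted as well, so upper bounds also hold when they are not.\<close>

fun formula_size :: "'a formula \<Rightarrow> nat" where
  "formula_size (Leaf a) = 1"
| "formula_size (Plus Fs) = 1 + sum_list (map formula_size Fs)"
| "formula_size (Times Fs) = 1 + sum_list (map formula_size Fs)"

fun formula_syntactic_multilinear :: "'a formula \<Rightarrow> bool" where
  "formula_syntactic_multilinear (Leaf a) \<longleftrightarrow> True"
| "formula_syntactic_multilinear (Plus Fs) \<longleftrightarrow>
     (\<forall>F \<in> set Fs. formula_syntactic_multilinear F)"
| "formula_syntactic_multilinear (Times Fs) \<longleftrightarrow>
     (\<forall>F \<in> set Fs. formula_syntactic_multilinear F) \<and>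
     sorted_wrt (\<lambda>F G. formula_vars F \<inter> formula_vars G = {}) Fs"

definition sum_of_monomials :: "'a formula \<Rightarrow> bool" where
  "sum_of_monomials Q \<longleftrightarrow> (\<exists>ass. Q = Plus (map (\<lambda>as. Times (map Leaf as)) ass))"

text \<open>
  \<open>sps_formula c n F\<close>: \<open>F\<close> is a \<open>\<Sigma>\<Pi>(\<Sigma>\<Pi>)\<close> formula over \<open>x\<^sub>1, \<dots>, x\<^sub>n\<close> in which both bounds \<open>O(\<surd>n)\<close>
  (on the fan-in of the upper products and on the number of variables of each factor) hold with
  the constant \<open>c\<close>.
\<close>

definition sps_formula :: "real \<Rightarrow> nat \<Rightarrow> 'a::comm_ring_1 formula \<Rightarrow> bool" where
  "sps_formula c n F \<longleftrightarrow>
     formula_vars F \<subseteq> {1..n} \<and>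
     (\<exists>Qss. F = Plus (map Times Qss) \<and>
        (\<forall>Qs \<in> set Qss. real (length Qs) \<le> c * sqrt (real n) \<and>
           (\<forall>Q \<in> set Qs. sum_of_monomials Q \<and> multilinear (formula_poly Q) \<and>
              real (card (formula_vars Q)) \<le> c * sqrt (real n))))"

end

theory Submission
  imports Defs
begin

text \<open>
  Let \<open>X(u, v)\<close> be the set of variables on the walks from \<open>u\<close> to \<open>v\<close>. Syntactic multilinearity makes
  \<open>X(u, v)\<close> and \<open>X(v, w)\<close> disjoint, and \<open>X(u, \<cdot>)\<close> grows along walks. Follow a walk from \<open>u\<close> up to the
  unique arc \<open>v \<rightarrow> w\<close> at which \<open>|X(u, \<cdot>)|\<close> first exceeds \<open>r = \<lfloor>\<surd>n\<rfloor>\<close>, and sum over the possible arcs: the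
  polynomial between \<open>u\<close> and \<open>t\<close> becomes a sum of products of a polynomial in the at most \<open>r\<close> variables
  \<open>X(u, v)\<close>, an arc label, and the polynomial between \<open>w\<close> and \<open>t\<close>. The variables
  \<open>X(u, w)\<close>, of which there are more than \<open>r\<close>, do not occur in the latter, so the recursion ends after
  at most \<open>r\<close> steps. Expanding every factor into monomials gives at most \<open>(S\<^sup>2 (n + 1))\<^sup>r\<close> products of
  at most \<open>2 r + 1\<close> factors with at most \<open>2\<^sup>r\<close> monomials each.
\<close>

section \<open>Multilinear polynomials as sums of monomials\<close>

text \<open>One inequality bounds exponents by 1 on V and by 0 outside V, so multilinearity and the
  restriction of the variables travel together through sums.\<close>

definition squarefree_over :: "nat set \<Rightarrow> 'a::zero mpoly \<Rightarrow> bool" where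
  "squarefree_over V p \<longleftrightarrow>
     (\<forall>m \<in> Poly_Mapping.keys p. \<forall>i. Poly_Mapping.lookup m i \<le> of_bool (i \<in> V))"

lemma squarefree_over_imp_multilinear: "squarefree_over V p \<Longrightarrow> multilinear p"
  unfolding squarefree_over_def multilinear_def
  by (metis le_trans of_bool_def order_refl zero_le_one)

lemma keys_sum_subset:
  "Poly_Mapping.keys (\<Sum>i\<in>I. b i) \<subseteq> (\<Union>i\<in>I. Poly_Mapping.keys (b i))"
proof (induction I rule: infinite_finite_induct)
  case (insert i I)
  then show ?case
    using Poly_Mapping.keys_add[of "b i" "\<Sum>i\<in>I. b i"] by auto
qed auto

lemma squarefree_over_sum:
  assumes "\<And>i. i \<in> I \<Longrightarrow> squarefree_over V (b i)"
  shows "squarefree_over V (\<Sum>i\<in>I. b i)"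
  using keys_sum_subset[of b I] assms unfolding squarefree_over_def by blast

lemma prod_list_variables:
  "prod_list (map (\<lambda>i. atom_poly (Variable i :: 'a::comm_ring_1 atom)) is) =
     Poly_Mapping.single (\<Sum>i\<leftarrow>is. Poly_Mapping.single i 1) 1"
  by (induction "is") (simp_all add: mult_single)

lemma distinct_list_count: "distinct xs \<Longrightarrow> count_list xs x = of_bool (x \<in> set xs)"
  by (induction xs) auto

lemma lookup_sum_list_singles:
  "Poly_Mapping.lookup (\<Sum>i\<leftarrow>is. Poly_Mapping.single i (1::nat)) j = count_list is j"
  by (induction "is") (auto simp: lookup_add lookup_single)

text \<open>An exponent vector with entries 0 and 1 is recovered from its support. This serves both
  to count monomials and to write them as products of distinct variable leaves.\<close>

lemma squarefree_monomial_eq: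
  assumes "\<And>i. Poly_Mapping.lookup m i \<le> 1"
  shows "m = (\<Sum>i\<leftarrow>sorted_list_of_set (Poly_Mapping.keys m). Poly_Mapping.single i (1::nat))"
proof (rule poly_mapping_eqI)
  fix j
  have "count_list (sorted_list_of_set (Poly_Mapping.keys m)) j
      = of_bool (j \<in> Poly_Mapping.keys m)"
    by (simp add: distinct_list_count)
  also have "\<dots> = Poly_Mapping.lookup m j"
    using assms[of j] by (auto simp: in_keys_iff of_bool_def)
  finally show "Poly_Mapping.lookup m j = Poly_Mapping.lookup
      (\<Sum>i\<leftarrow>sorted_list_of_set (Poly_Mapping.keys m). Poly_Mapping.single i (1::nat)) j"
    by (simp only: lookup_sum_list_singles)
qed

lemma sum_single_lookup:
  "(\<Sum>m\<in>Poly_Mapping.keys p. Poly_Mapping.single m (Poly_Mapping.lookup p m)) = p"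
proof (rule poly_mapping_eqI)
  fix k
  show "Poly_Mapping.lookup (\<Sum>m\<in>Poly_Mapping.keys p.
      Poly_Mapping.single m (Poly_Mapping.lookup p m)) k = Poly_Mapping.lookup p k"
    by (auto simp: lookup_sum lookup_single when_def in_keys_iff)
qed

text \<open>The coefficient becomes a leaf without variables and each variable of the support one
  leaf, so for a squarefree m these are the leaves of a syntactic multilinear product computing the
  term of m in p.\<close>

definition monomial_atoms :: "'a::zero mpoly \<Rightarrow> (nat \<Rightarrow>\<^sub>0 nat) \<Rightarrow> 'a atom list" where
  "monomial_atoms p m = Constant (Poly_Mapping.lookup p m) #
     map Variable (sorted_list_of_set (Poly_Mapping.keys m))"

text \<open>Taking supports is injective on squarefree monomials and lands in the power set of
  V.\<close>

lemma card_squarefree_keys: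
  assumes "finite V" and "squarefree_over V p"
  shows "card (Poly_Mapping.keys p) \<le> 2 ^ card V"
proof -
  have "inj_on Poly_Mapping.keys (Poly_Mapping.keys p)"
  proof (rule inj_onI)
    fix m m' assume "m \<in> Poly_Mapping.keys p" "m' \<in> Poly_Mapping.keys p"
      and eq: "Poly_Mapping.keys m = Poly_Mapping.keys m'"
    then have "\<And>i. Poly_Mapping.lookup m i \<le> 1" "\<And>i. Poly_Mapping.lookup m' i \<le> 1"
      using squarefree_over_imp_multilinear[OF assms(2)] unfolding multilinear_def by blast+
    then show "m = m'"
      using squarefree_monomial_eq[of m] squarefree_monomial_eq[of m'] eq by metis
  qed
  moreover have "Poly_Mapping.keys ` Poly_Mapping.keys p \<subseteq> Pow V"
  proof (rule image_subsetI, rule PowI, rule subsetI)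
    fix m i assume "m \<in> Poly_Mapping.keys p" and i: "i \<in> Poly_Mapping.keys m"
    then have "Poly_Mapping.lookup m i \<le> of_bool (i \<in> V)"
      using assms(2) unfolding squarefree_over_def by blast
    then show "i \<in> V" using i by (auto simp: in_keys_iff of_bool_def split: if_splits)
  qed
  ultimately show ?thesis
    using card_inj_on_le[of Poly_Mapping.keys "Poly_Mapping.keys p" "Pow V"] assms(1)
    by (simp add: card_Pow)
qed

lemma sum_of_monomials_exists:
  fixes p :: "'a::comm_ring_1 mpoly"
  assumes "finite V" and "squarefree_over V p"
  obtains Q where "sum_of_monomials Q" "formula_syntactic_multilinear Q" "formula_poly Q = p"
    "formula_vars Q \<subseteq> V" "formula_size Q \<le> 1 + 2 ^ card V * (card V + 2)"
proof -
  obtain ms where ms: "set ms = Poly_Mapping.keys p" "distinct ms"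
    using finite_distinct_list[OF finite_keys[of p]] by auto
  define Q where "Q = Plus (map (\<lambda>as. Times (map Leaf as)) (map (monomial_atoms p) ms))"
  have sqf: "Poly_Mapping.lookup m i \<le> of_bool (i \<in> V)" if "m \<in> set ms" for m i
    using assms(2) that by (simp add: squarefree_over_def ms(1))
  have keys: "Poly_Mapping.keys m \<subseteq> V" if "m \<in> set ms" for m
  proof
    fix i assume "i \<in> Poly_Mapping.keys m"
    then show "i \<in> V" using sqf[OF that, of i] by (auto simp: in_keys_iff of_bool_def split: if_splits)
  qed
  have "formula_poly (Times (map Leaf (monomial_atoms p m))) =
      Poly_Mapping.single m (Poly_Mapping.lookup p m)" if "m \<in> set ms" for m
  proof -
    have "Poly_Mapping.lookup m i \<le> 1" for i
      using sqf[OF that, of i] by (simp add: of_bool_def split: if_splits)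
    note m = squarefree_monomial_eq[OF this]
    have "(\<Prod>i\<leftarrow>sorted_list_of_set (Poly_Mapping.keys m). atom_poly (Variable i :: 'a atom))
        = Poly_Mapping.single m 1"
      unfolding prod_list_variables m[symmetric] ..
    then show ?thesis
      by (simp add: monomial_atoms_def o_def mult_single)
  qed
  then have "formula_poly Q =
      (\<Sum>m\<leftarrow>ms. Poly_Mapping.single m (Poly_Mapping.lookup p m))"
    unfolding Q_def formula_poly.simps(2) map_map
    by (intro arg_cong[of _ _ sum_list] map_cong) auto
  then have poly: "formula_poly Q = p"
    using ms by (simp add: sum_list_distinct_conv_sum_set sum_single_lookup)
  \<comment> \<open>One product gate, one coefficient leaf and at most |V| variable leaves.\<close>
  have "formula_size (Times (map Leaf (monomial_atoms p m))) \<le> card V + 2" if "m \<in> set ms" for m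
  proof -
    have "card (Poly_Mapping.keys m) \<le> card V"
      using keys[OF that] assms(1) by (simp add: card_mono)
    then show ?thesis
      by (simp add: monomial_atoms_def o_def sum_list_triv)
  qed
  then have "(\<Sum>m\<leftarrow>ms. formula_size (Times (map Leaf (monomial_atoms p m))))
      \<le> (\<Sum>m\<leftarrow>ms. card V + 2)"
    by (rule sum_list_mono)
  also have "\<dots> = card (Poly_Mapping.keys p) * (card V + 2)"
    unfolding sum_list_triv of_nat_id distinct_card[OF ms(2), symmetric] ms(1) ..
  also have "\<dots> \<le> 2 ^ card V * (card V + 2)"
    by (rule mult_right_mono[OF card_squarefree_keys[OF assms] zero_le])
  finally have size: "formula_size Q \<le> 1 + 2 ^ card V * (card V + 2)"
    by (simp add: Q_def o_def)
  have "formula_syntactic_multilinear (Times (map Leaf (monomial_atoms p m)))" for m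
    by (simp add: monomial_atoms_def sorted_wrt_map)
       (use distinct_sorted_list_of_set[of "Poly_Mapping.keys m"] in
         \<open>simp add: distinct_conv_nth sorted_wrt_iff_nth_less\<close>)
  then have "formula_syntactic_multilinear Q"
    by (auto simp: Q_def)
  moreover have "formula_vars Q \<subseteq> V"
    using keys by (auto simp: Q_def monomial_atoms_def)
  moreover have "sum_of_monomials Q"
    unfolding Q_def sum_of_monomials_def by blast
  ultimately show thesis
    using that poly size by blast
qed

section \<open>Sums of products of small, variable-disjoint factors\<close>

definition factor :: "nat \<Rightarrow> nat set \<Rightarrow> 'a::comm_ring_1 formula \<Rightarrow> bool" where
  "factor r V Q \<longleftrightarrow> sum_of_monomials Q \<and> formula_syntactic_multilinear Q \<and>
     multilinear (formula_poly Q) \<and> formula_vars Q \<subseteq> V \<and> card (formula_vars Q) \<le> r \<and>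
     formula_size Q \<le> 1 + 2 ^ r * (r + 2)"

lemma factor_exists:
  fixes p :: "'a::comm_ring_1 mpoly"
  assumes "finite V" and "squarefree_over V p" and "card V \<le> r"
  obtains Q where "factor r V Q" "formula_poly Q = p"
proof -
  obtain Q where Q: "sum_of_monomials Q" "formula_syntactic_multilinear Q" "formula_poly Q = p"
    "formula_vars Q \<subseteq> V" "formula_size Q \<le> 1 + 2 ^ card V * (card V + 2)"
    using sum_of_monomials_exists[OF assms(1,2)] .
  have "(2::nat) ^ card V * (card V + 2) \<le> 2 ^ r * (r + 2)"
    using assms(3) by (intro mult_mono power_increasing) auto
  moreover have "card (formula_vars Q) \<le> r"
    using card_mono[OF assms(1) Q(4)] assms(3) by simp
  ultimately show thesis
    using that[of Q] Q squarefree_over_imp_multilinear[OF assms(2)] unfolding factor_def by simp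
qed

text \<open>The inner lists are the products. The number k counts crossings: each contributes two
  factors, a walk segment and an arc label, and the last segment contributes one more, hence 2 k +
  1.\<close>

definition product_sum ::
  "nat \<Rightarrow> nat \<Rightarrow> nat set \<Rightarrow> 'a::comm_ring_1 formula list list \<Rightarrow> bool" where
  "product_sum r k V Qss \<longleftrightarrow> (\<forall>Qs\<in>set Qss. length Qs \<le> 2 * k + 1 \<and>
     sorted_wrt (\<lambda>F G. formula_vars F \<inter> formula_vars G = {}) Qs \<and> (\<forall>Q\<in>set Qs. factor r V Q))"

definition products_poly :: "'a::comm_ring_1 formula list list \<Rightarrow> 'a mpoly" where
  "products_poly Qss = (\<Sum>Qs\<leftarrow>Qss. \<Prod>Q\<leftarrow>Qs. formula_poly Q)"

text \<open>In \<open>factor\<close> the number r bounds the variables that occur, independently of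
  the size of V. So V may grow to the variables of the whole walk during the recursion.\<close>

lemma product_sum_mono: "product_sum r k V Qss \<Longrightarrow> V \<subseteq> W \<Longrightarrow> product_sum r k W Qss"
  unfolding product_sum_def factor_def by blast

lemma product_sum_concat:
  "(\<And>Qss. Qss \<in> set Qsss \<Longrightarrow> product_sum r k V Qss) \<Longrightarrow> product_sum r k V (concat Qsss)"
  unfolding product_sum_def set_concat by blast

lemma products_poly_concat:
  "products_poly (concat Qsss) = (\<Sum>Qss\<leftarrow>Qsss. products_poly Qss)"
  by (induction Qsss) (simp_all add: products_poly_def)

text \<open>One recursion step: Q is for the segment before the crossing arc, R for the arc, and the
  old products for the rest. Pairwise disjointness of U, W and V preserves syntactic
  multilinearity.\<close>

lemma product_sum_extend:
  fixes Qss :: "'a::comm_ring_1 formula list list"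
  assumes "product_sum r k V Qss" and "factor r U Q" and "factor r W R"
    and "U \<inter> W = {}" and "U \<inter> V = {}" and "W \<inter> V = {}"
  shows "product_sum r (Suc k) (U \<union> W \<union> V) (map (\<lambda>Qs. Q # R # Qs) Qss)"
    and "products_poly (map (\<lambda>Qs. Q # R # Qs) Qss)
      = formula_poly Q * formula_poly R * products_poly Qss"
proof -
  show "product_sum r (Suc k) (U \<union> W \<union> V) (map (\<lambda>Qs. Q # R # Qs) Qss)"
    using assms unfolding product_sum_def factor_def by simp blast
  show "products_poly (map (\<lambda>Qs. Q # R # Qs) Qss)
      = formula_poly Q * formula_poly R * products_poly Qss"
    unfolding products_poly_def by (simp add: o_def mult.assoc sum_list_const_mult)
qed

lemma formula_size_product_sum:
  assumes "product_sum r k V Qss"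
  shows "formula_size (Plus (map Times Qss))
    \<le> 1 + length Qss * (1 + (2 * k + 1) * (1 + 2 ^ r * (r + 2)))"
proof -
  have "formula_size (Times Qs) \<le> 1 + (2 * k + 1) * (1 + 2 ^ r * (r + 2))"
    if "Qs \<in> set Qss" for Qs
  proof -
    have "(\<Sum>Q\<leftarrow>Qs. formula_size Q) \<le> (\<Sum>Q\<leftarrow>Qs. 1 + 2 ^ r * (r + 2))"
      using assms that by (intro sum_list_mono) (auto simp: product_sum_def factor_def)
    also have "\<dots> = length Qs * (1 + 2 ^ r * (r + 2))"
      by (simp only: sum_list_triv of_nat_id)
    also have "\<dots> \<le> (2 * k + 1) * (1 + 2 ^ r * (r + 2))"
      using assms that by (intro mult_right_mono) (auto simp: product_sum_def)
    finally show ?thesis by simp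
  qed
  then have "(\<Sum>Qs\<leftarrow>Qss. formula_size (Times Qs))
      \<le> (\<Sum>Qs\<leftarrow>Qss. 1 + (2 * k + 1) * (1 + 2 ^ r * (r + 2)))"
    by (rule sum_list_mono)
  also have "\<dots> = length Qss * (1 + (2 * k + 1) * (1 + 2 ^ r * (r + 2)))"
    by (simp only: sum_list_triv of_nat_id)
  finally show ?thesis by (simp add: o_def)
qed

section \<open>Walks in layered digraphs\<close>

locale layered_digraph = fin_digraph G for G :: "('v, 'e) pre_digraph" +
  fixes layer :: "'v \<Rightarrow> nat" and lab :: "'e \<Rightarrow> 'a::comm_ring_1 atom"
  assumes layer_head: "e \<in> arcs G \<Longrightarrow> layer (head G e) = Suc (layer (tail G e))"
begin

text \<open>Walks rather than paths, since walks concatenate freely; by the layering both notions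
  agree.\<close>

definition walks :: "'v \<Rightarrow> 'v \<Rightarrow> 'e list set" where
  "walks u v = {p. awalk u p v}"

definition walk_poly :: "'e list \<Rightarrow> 'a mpoly" where
  "walk_poly p = (\<Prod>e\<leftarrow>p. atom_poly (lab e))"

definition between_poly :: "'v \<Rightarrow> 'v \<Rightarrow> 'a mpoly" where
  "between_poly u v = (\<Sum>p\<in>walks u v. walk_poly p)"

definition between_vars :: "'v \<Rightarrow> 'v \<Rightarrow> nat set" where
  "between_vars u v = (\<Union>p\<in>walks u v. \<Union>e\<in>set p. atom_vars (lab e))"

lemma layer_awalk: "awalk u p v \<Longrightarrow> layer v = layer u + length p"
  by (induction p arbitrary: u) (auto simp: awalk_simps layer_head)

lemma finite_walks: "finite (walks u v)"
proof (rule finite_subset)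
  show "walks u v \<subseteq> {p. set p \<subseteq> arcs G \<and> length p = layer v - layer u}"
    using layer_awalk by (auto simp: walks_def)
  show "finite {p. set p \<subseteq> arcs G \<and> length p = layer v - layer u}"
    by (rule finite_lists_length_eq[OF finite_arcs])
qed

lemma walks_refl: "v \<in> verts G \<Longrightarrow> walks v v = {[]}"
  using layer_awalk[of v _ v] by (auto simp: walks_def awalk_Nil_iff)

lemma walks_trans: "walks u v \<noteq> {} \<Longrightarrow> walks v w \<noteq> {} \<Longrightarrow> walks u w \<noteq> {}"
  unfolding walks_def using awalk_appendI by blast

text \<open>With v = t this provides the empty walk as the continuation to t demanded by the lemmas
  on syntactic multilinearity.\<close>

lemma walks_target: "walks u v \<noteq> {} \<Longrightarrow> walks v v \<noteq> {}"
  using walks_refl by (auto simp: walks_def)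

lemma walks_arc: "e \<in> arcs G \<Longrightarrow> walks (tail G e) (head G e) \<noteq> {}"
  unfolding walks_def using arc_implies_awalk by blast

lemma awalk_imp_apath:
  assumes "awalk u p v"
  shows "apath u p v"
proof -
  \<comment> \<open>The layer bound strengthens the induction: all vertices after the first arc lie
    in layers above that of u, so u does not recur.\<close>
  have "distinct (awalk_verts u p) \<and> (\<forall>w\<in>set (awalk_verts u p). layer u \<le> layer w)"
    using assms
  proof (induction p arbitrary: u)
    case (Cons e p)
    then show ?case
      using layer_head[of e] by (fastforce simp: awalk_Cons_iff)
  qed simp
  then show ?thesis
    using assms by (simp add: apath_def)
qed

lemma finite_atom_vars: "finite (atom_vars a)"
  by (cases a) auto

lemma finite_between_vars: "finite (between_vars u v)"
  unfolding between_vars_def using finite_walks finite_atom_vars by auto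

lemma between_vars_refl: "v \<in> verts G \<Longrightarrow> between_vars v v = {}"
  by (simp add: between_vars_def walks_refl)

lemma between_vars_mono_head:
  assumes "awalk v p w"
  shows "between_vars u v \<subseteq> between_vars u w"
proof -
  have "q @ p \<in> walks u w" if "q \<in> walks u v" for q
    using that assms by (auto simp: walks_def)
  then show ?thesis
    unfolding between_vars_def by fastforce
qed

lemma between_vars_mono_tail:
  assumes "awalk u p v"
  shows "between_vars v w \<subseteq> between_vars u w"
proof -
  have "p @ q \<in> walks u w" if "q \<in> walks v w" for q
    using that assms by (auto simp: walks_def)
  then show ?thesis
    unfolding between_vars_def by fastforce
qed

lemma atom_vars_subset_between_vars:
  assumes "e \<in> arcs G"
  shows "atom_vars (lab e) \<subseteq> between_vars (tail G e) (head G e)"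
proof -
  have "[e] \<in> walks (tail G e) (head G e)"
    using arc_implies_awalk[OF assms] by (simp add: walks_def)
  then show ?thesis
    unfolding between_vars_def by (metis (no_types, lifting) UN_upper list.set_intros(1) subset_trans)
qed

lemma awalk_split: "awalk u (p @ e # q) v \<longleftrightarrow>
    awalk u p (tail G e) \<and> e \<in> arcs G \<and> awalk (head G e) q v"
  by (auto simp: awalk_Cons_iff)

text \<open>The two nonemptiness conditions select arcs that lie on a walk from u to t; they also
  yield the walks needed to apply syntactic multilinearity on either side of the arc.\<close>

definition crossing_arcs :: "nat \<Rightarrow> 'v \<Rightarrow> 'v \<Rightarrow> 'e set" where
  "crossing_arcs r u t = {e \<in> arcs G. card (between_vars u (tail G e)) \<le> r \<and>
     r < card (between_vars u (head G e)) \<and>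
     walks u (tail G e) \<noteq> {} \<and> walks (head G e) t \<noteq> {}}"

lemma finite_crossing_arcs: "finite (crossing_arcs r u t)"
  by (simp add: crossing_arcs_def)

text \<open>A discrete intermediate value argument. The start v is kept apart from u so that the
  induction can drop leading arcs while variables are still counted from u.\<close>

lemma walk_crosses:
  assumes "awalk v w t" and "card (between_vars u v) \<le> r" and "r < card (between_vars u t)"
  shows "\<exists>p e q. w = p @ e # q \<and> card (between_vars u (tail G e)) \<le> r \<and>
     r < card (between_vars u (head G e))"
  using assms
proof (induction w arbitrary: v)
  case Nil
  then show ?case by (simp add: awalk_Nil_iff)
next
  case (Cons e w)
  show ?case
  proof (cases "card (between_vars u (head G e)) \<le> r")
    case True
    then obtain p e' q where "w = p @ e' # q" "card (between_vars u (tail G e')) \<le> r"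
      "r < card (between_vars u (head G e'))"
      using Cons.IH[of "head G e"] Cons.prems unfolding awalk_Cons_iff by blast
    then show ?thesis
      by (metis append_Cons)
  next
    case False
    then show ?thesis
      using Cons.prems by (fastforce simp: awalk_Cons_iff)
  qed
qed

text \<open>Since \<open>between_vars u\<close> grows along walks, the arc at which its size first exceeds \<open>r\<close> is
  determined by the walk.\<close>

lemma crossing_unique:
  assumes "p @ e # q = p' @ e' # q'"
    and "awalk u (p @ e # q) t" and "e \<in> crossing_arcs r u t" and "e' \<in> crossing_arcs r u t"
  shows "length p' \<le> length p"
proof (rule ccontr)
  \<comment> \<open>If p' is longer, it contains e, so a walk leads from the head of e to the tail
    of e'. The count exceeds r at the former, yet is at most r at the latter.\<close>
  assume "\<not> length p' \<le> length p"
  then obtain z where z: "p' = p @ e # z"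
    using assms(1) by (auto simp: append_eq_append_conv2 Cons_eq_append_conv)
  have "awalk u p' (tail G e')"
    using assms(1,2) awalk_split by metis
  then have "awalk (head G e) z (tail G e')"
    unfolding z by (simp only: awalk_split)
  then have "between_vars u (head G e) \<subseteq> between_vars u (tail G e')"
    by (rule between_vars_mono_head)
  then have "card (between_vars u (head G e)) \<le> card (between_vars u (tail G e'))"
    by (intro card_mono finite_between_vars)
  then show False
    using assms(3,4) unfolding crossing_arcs_def by simp
qed

text \<open>Splitting at the crossing arc is a bijection between walks and triples of an arc, a walk
  before it and a walk after it; the sum over triples then factors.\<close>

lemma between_poly_crossing:
  assumes "u \<in> verts G" and "r < card (between_vars u t)"
  shows "between_poly u t = (\<Sum>e\<in>crossing_arcs r u t.
    between_poly u (tail G e) * atom_poly (lab e) * between_poly (head G e) t)"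
proof -
  let ?C = "crossing_arcs r u t"
  let ?D = "Sigma ?C (\<lambda>e. walks u (tail G e) \<times> walks (head G e) t)"
  let ?join = "\<lambda>(e, p, q). p @ e # q"
  have "inj_on ?join ?D"
  proof (rule inj_onI)
    fix x y assume x: "x \<in> ?D" and y: "y \<in> ?D" and eq: "?join x = ?join y"
    obtain e p q e' p' q' where xy: "x = (e, p, q)" "y = (e', p', q')"
      by (metis surj_pair)
    have "awalk u (p @ e # q) t" "awalk u (p' @ e' # q') t"
      using x y by (auto simp: xy walks_def crossing_arcs_def awalk_Cons_iff)
    then have "length p = length p'"
      using crossing_unique[of p e q p' e' q' u t r] crossing_unique[of p' e' q' p e q u t r]
        x y eq by (simp add: xy)
    then show "x = y"
      using eq by (simp add: xy)
  qed
  moreover have "?join ` ?D = walks u t"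
  proof (intro equalityI subsetI)
    fix w assume "w \<in> ?join ` ?D"
    then show "w \<in> walks u t"
      by (auto simp: walks_def crossing_arcs_def awalk_Cons_iff)
  next
    fix w assume "w \<in> walks u t"
    then have w: "awalk u w t"
      by (simp add: walks_def)
    \<comment> \<open>The count starts at 0 because \<open>between_vars u u\<close> is empty, and it
      ends above r.\<close>
    then obtain p e q where s: "w = p @ e # q" "card (between_vars u (tail G e)) \<le> r"
      "r < card (between_vars u (head G e))"
      using walk_crosses[of u w t u r] assms by (auto simp: between_vars_refl)
    then have "(e, p, q) \<in> ?D"
      using w unfolding s(1) awalk_split by (auto simp: crossing_arcs_def walks_def)
    then show "w \<in> ?join ` ?D"
      using s(1) by force
  qed
  ultimately have "bij_betw ?join ?D (walks u t)"
    by (simp add: bij_betw_def)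
  then have "between_poly u t = (\<Sum>x\<in>?D. walk_poly (?join x))"
    unfolding between_poly_def by (rule sum.reindex_bij_betw[symmetric])
  also have "\<dots> = (\<Sum>e\<in>?C. \<Sum>(p, q)\<in>walks u (tail G e) \<times> walks (head G e) t.
      walk_poly p * atom_poly (lab e) * walk_poly q)"
    by (subst sum.Sigma)
      (auto simp: finite_crossing_arcs finite_walks walk_poly_def mult.assoc intro!: sum.cong)
  also have "\<dots> = (\<Sum>e\<in>?C.
      between_poly u (tail G e) * atom_poly (lab e) * between_poly (head G e) t)"
    by (simp only: between_poly_def flip: sum.cartesian_product sum_distrib_left sum_distrib_right)
  finally show ?thesis .
qed

text \<open>The bridge from labels to polynomials: a bound on label occurrences bounds
  exponents.\<close>

lemma lookup_walk_poly_keys: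
  assumes "m \<in> Poly_Mapping.keys (walk_poly p)"
  shows "Poly_Mapping.lookup m i \<le> count_list (map lab p) (Variable i)"
  using assms
proof (induction p arbitrary: m)
  case Nil
  then show ?case by (simp add: walk_poly_def)
next
  case (Cons e p)
  then have "m \<in> Poly_Mapping.keys (atom_poly (lab e) * walk_poly p)"
    by (simp add: walk_poly_def)
  then obtain a b where ab: "a \<in> Poly_Mapping.keys (atom_poly (lab e))"
    "b \<in> Poly_Mapping.keys (walk_poly p)" "m = a + b"
    using keys_mult by blast
  have "Poly_Mapping.lookup a i \<le> of_bool (lab e = Variable i)"
    using ab(1) by (cases "lab e") (auto simp: lookup_single split: if_splits)
  then show ?case
    using Cons.IH[OF ab(2)] by (auto simp: ab(3) lookup_add)
qed

end

section \<open>Consequences of syntactic multilinearity and the recursive expansion\<close>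

locale multilinear_program = layered_digraph G layer lab
  for G :: "('v, 'e) pre_digraph" and layer and lab :: "'e \<Rightarrow> 'a::comm_ring_1 atom" +
  fixes s t :: 'v and n :: nat
  assumes at_most_once: "awalk s p t \<Longrightarrow> count_list (map lab p) (Variable i) \<le> 1"
    and atom_vars_bound: "e \<in> arcs G \<Longrightarrow> atom_vars (lab e) \<subseteq> {1..n}"
begin

lemma between_vars_bound: "between_vars u v \<subseteq> {1..n}"
  using atom_vars_bound unfolding between_vars_def walks_def by blast

lemma between_varsE:
  assumes "i \<in> between_vars u v"
  obtains p where "awalk u p v" "count_list (map lab p) (Variable i) \<ge> 1"
proof -
  obtain p e where pe: "awalk u p v" "e \<in> set p" "i \<in> atom_vars (lab e)"
    using assms by (auto simp: between_vars_def walks_def)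
  then have "Variable i \<in> set (map lab p)"
    by (cases "lab e") force+
  then have "count_list (map lab p) (Variable i) \<noteq> 0"
    unfolding count_list_0_iff by simp
  then show thesis
    using that pe(1) by simp
qed

text \<open>Syntactic multilinearity speaks only of walks from s to t, so the assumptions supply
  walks from s to u and from w to t. A common variable would then occur twice on a walk from s
  through u, v and w to t.\<close>

lemma between_vars_disjoint:
  assumes "walks s u \<noteq> {}" and "walks w t \<noteq> {}"
  shows "between_vars u v \<inter> between_vars v w = {}"
proof (rule ccontr)
  assume "between_vars u v \<inter> between_vars v w \<noteq> {}"
  then obtain i where "i \<in> between_vars u v" "i \<in> between_vars v w"
    by blast
  then obtain p q where p: "awalk u p v" "count_list (map lab p) (Variable i) \<ge> 1"
    and q: "awalk v q w" "count_list (map lab q) (Variable i) \<ge> 1"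
    by (metis between_varsE)
  obtain a b where "awalk s a u" "awalk w b t"
    using assms by (auto simp: walks_def)
  then have "awalk s (a @ p @ q @ b) t"
    using p q by auto
  then have "count_list (map lab (a @ p @ q @ b)) (Variable i) \<le> 1"
    by (rule at_most_once)
  then show False
    using p q by simp
qed

lemma squarefree_between_poly:
  assumes "walks s u \<noteq> {}" and "walks v t \<noteq> {}"
  shows "squarefree_over (between_vars u v) (between_poly u v)"
  unfolding between_poly_def
proof (rule squarefree_over_sum)
  fix p assume "p \<in> walks u v"
  then have p: "awalk u p v"
    by (simp add: walks_def)
  have "count_list (map lab p) (Variable i) \<le> of_bool (i \<in> between_vars u v)" for i
  proof (cases "i \<in> between_vars u v")
    case True
    obtain a b where "awalk s a u" "awalk v b t"
      using assms by (auto simp: walks_def)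
    then have "awalk s (a @ p @ b) t"
      using p by auto
    then have "count_list (map lab (a @ p @ b)) (Variable i) \<le> 1"
      by (rule at_most_once)
    then show ?thesis
      using True by simp
  next
    case False
    have "Variable i \<notin> set (map lab p)"
    proof
      assume "Variable i \<in> set (map lab p)"
      then obtain e where "e \<in> set p" "lab e = Variable i" by auto
      then have "i \<in> between_vars u v"
        using p unfolding between_vars_def walks_def by force
      then show False using False by simp
    qed
    then show ?thesis by simp
  qed
  then show "squarefree_over (between_vars u v) (walk_poly p)"
    unfolding squarefree_over_def using lookup_walk_poly_keys le_trans by blast
qed

text \<open>Only the variables of a label are kept, not its constant. The labels of one kind add up
  to a constant or to a multiple of a single variable, so all arcs of a kind share one
  factor.\<close>

definition arc_kind :: "'e \<Rightarrow> 'v \<times> 'v \<times> nat set" where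
  "arc_kind e = (tail G e, head G e, atom_vars (lab e))"

text \<open>Two endpoints, and either no variable or one of n variables.\<close>

definition kinds_bound :: nat where
  "kinds_bound = card (verts G) ^ 2 * (n + 1)"

text \<open>Parallel arcs are unbounded in number, so arcs are counted only up to their kind.\<close>

lemma card_arc_kinds:
  assumes "A \<subseteq> arcs G"
  shows "card (arc_kind ` A) \<le> kinds_bound"
proof -
  let ?U = "insert {} ((\<lambda>i. {i}) ` {1..n})"
  have "atom_vars (lab e) \<in> ?U" if "e \<in> A" for e
    using atom_vars_bound[of e] that assms by (cases "lab e") auto
  then have "arc_kind ` A \<subseteq> verts G \<times> verts G \<times> ?U"
    using assms by (auto simp: arc_kind_def)
  then have "card (arc_kind ` A) \<le> card (verts G \<times> verts G \<times> ?U)"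
    by (intro card_mono) auto
  also have "\<dots> = card (verts G) ^ 2 * card ?U"
    by (simp only: card_cartesian_product power2_eq_square mult.assoc)
  also have "\<dots> \<le> kinds_bound"
    unfolding kinds_bound_def
    using card_insert_le_m1[of "n + 1" "(\<lambda>i. {i}) ` {1..n}" "{}"]
      card_image_le[of "{1..n}" "\<lambda>i. {i}"]
    by (intro mult_left_mono) auto
  finally show ?thesis .
qed

lemma squarefree_atom_poly: "squarefree_over (atom_vars a) (atom_poly a :: 'a mpoly)"
  by (cases a) (auto simp: squarefree_over_def lookup_single when_def split: if_splits)

lemma between_poly_small:
  assumes "walks s u \<noteq> {}" and "walks v t \<noteq> {}" and "card (between_vars u v) \<le> r"
  obtains Q where "factor r (between_vars u v) Q" "formula_poly Q = between_poly u v"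
  using factor_exists[OF finite_between_vars squarefree_between_poly] assms by blast

lemma between_poly_crossing_kinds:
  assumes "u \<in> verts G" and "r < card (between_vars u t)"
  shows "between_poly u t = (\<Sum>(v, w, V)\<in>arc_kind ` crossing_arcs r u t. between_poly u v *
    (\<Sum>e\<in>{e \<in> crossing_arcs r u t. arc_kind e = (v, w, V)}. atom_poly (lab e)) *
    between_poly w t)"
proof -
  have "between_poly u t = (\<Sum>\<kappa>\<in>arc_kind ` crossing_arcs r u t.
      \<Sum>e\<in>{e \<in> crossing_arcs r u t. arc_kind e = \<kappa>}.
        between_poly u (tail G e) * atom_poly (lab e) * between_poly (head G e) t)"
    unfolding between_poly_crossing[OF assms] by (rule sum.image_gen[OF finite_crossing_arcs])
  also have "\<dots> = (\<Sum>(v, w, V)\<in>arc_kind ` crossing_arcs r u t.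
      \<Sum>e\<in>{e \<in> crossing_arcs r u t. arc_kind e = (v, w, V)}.
        between_poly u v * atom_poly (lab e) * between_poly w t)"
    by (auto simp: arc_kind_def intro!: sum.cong)
  finally show ?thesis
    by (simp add: sum_distrib_left sum_distrib_right)
qed

text \<open>The arc e only represents its kind. B stands for the sum of all labels of that kind, of
  which squarefreeness over V is all that enters.\<close>

lemma crossing_arc_expansion:
  assumes "1 \<le> r" and u: "walks s u \<noteq> {}" and "e \<in> crossing_arcs r u t"
    and "tail G e = v" "head G e = w" "atom_vars (lab e) = V"
    and B: "squarefree_over V B"
    and Qss: "product_sum r k (between_vars w t) Qss" "products_poly Qss = between_poly w t"
  obtains Qss' where "product_sum r (Suc k) (between_vars u t) Qss'"
    "products_poly Qss' = between_poly u v * B * between_poly w t" "length Qss' = length Qss"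
proof -
  have e: "e \<in> arcs G" "card (between_vars u v) \<le> r" "walks u v \<noteq> {}" "walks w t \<noteq> {}"
    using assms(3-6) unfolding crossing_arcs_def by auto
  obtain a b where ab: "awalk u a v" "awalk w b t"
    using e by (auto simp: walks_def)
  have vw: "awalk v [e] w"
    using arc_implies_awalk[OF e(1)] assms by simp
  have vt: "awalk v ([e] @ b) t" and uw: "awalk u (a @ [e]) w"
    using awalk_appendI[OF vw ab(2)] awalk_appendI[OF ab(1) vw] by simp_all
  have v: "walks s v \<noteq> {}" and vt': "walks v t \<noteq> {}" and tt: "walks t t \<noteq> {}"
    using walks_trans[OF u e(3)] walks_trans[OF walks_arc[OF e(1)]] e(4) walks_target assms(4,5)
    by auto
  have V_vw: "V \<subseteq> between_vars v w"
    using atom_vars_subset_between_vars[OF e(1)] assms by simp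
  have V_ut: "V \<subseteq> between_vars u t" and V_vt: "V \<subseteq> between_vars v t"
    and V_uw: "V \<subseteq> between_vars u w"
    using V_vw between_vars_mono_head[OF ab(2), of v] between_vars_mono_tail[OF ab(1)] by blast+
  have uv_uw: "between_vars u v \<subseteq> between_vars u w"
    by (rule between_vars_mono_head[OF vw])
  \<comment> \<open>The cut at v separates the first segment from the arc; the cut at w separates
    both from the remainder.\<close>
  have disj: "between_vars u v \<inter> between_vars v t = {}" "between_vars u w \<inter> between_vars w t = {}"
    by (rule between_vars_disjoint[OF u tt])+
  obtain Q where Q: "factor r (between_vars u v) Q" "formula_poly Q = between_poly u v"
    using between_poly_small[OF u vt' e(2)] .
  \<comment> \<open>A label has at most one variable, which fits since r is at least 1.\<close>
  have "finite V" "card V \<le> r"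
    using assms(1,6) by (cases "lab e"; force)+
  then obtain R where R: "factor r V R" "formula_poly R = B"
    using factor_exists B by metis
  let ?Qss' = "map (\<lambda>Qs. Q # R # Qs) Qss"
  have "between_vars u v \<inter> V = {}" "between_vars u v \<inter> between_vars w t = {}"
    "V \<inter> between_vars w t = {}"
    using disj V_vt V_uw uv_uw by blast+
  note ext = product_sum_extend[OF Qss(1) Q(1) R(1) this]
  have "between_vars u v \<union> V \<union> between_vars w t \<subseteq> between_vars u t"
    using V_ut between_vars_mono_head[OF vt, of u] between_vars_mono_tail[OF uw, of t] by blast
  then show thesis
    using that[of ?Qss'] product_sum_mono[OF ext(1)] ext(2) Q(2) R(2) Qss(2) by simp
qed

text \<open>The variables before and after the head of e are disjoint subsets of those from u to t,
  and the former number at least r + 1. This makes the recursion terminate.\<close>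

lemma card_between_vars_after_crossing:
  assumes "walks s u \<noteq> {}" and "e \<in> crossing_arcs r u t"
  shows "card (between_vars (head G e) t) + (r + 1) \<le> card (between_vars u t)"
proof -
  let ?w = "head G e"
  have e: "e \<in> arcs G" "r < card (between_vars u ?w)" "walks u (tail G e) \<noteq> {}" "walks ?w t \<noteq> {}"
    using assms(2) unfolding crossing_arcs_def by auto
  obtain a b where ab: "awalk u a (tail G e)" "awalk ?w b t"
    using e by (auto simp: walks_def)
  then have uw: "awalk u (a @ [e]) ?w"
    using arc_implies_awalk[OF e(1)] by auto
  have "card (between_vars u ?w \<union> between_vars ?w t)
      = card (between_vars u ?w) + card (between_vars ?w t)"
    using walks_target[OF e(4)]
    by (intro card_Un_disjoint finite_between_vars between_vars_disjoint assms(1))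
  moreover have "card (between_vars u ?w \<union> between_vars ?w t) \<le> card (between_vars u t)"
    using between_vars_mono_head[OF ab(2), of u] between_vars_mono_tail[OF uw, of t]
    by (intro card_mono finite_between_vars) auto
  ultimately show ?thesis
    using e(2) by simp
qed

text \<open>Here k is the number of crossings still allowed: each uses up r + 1 variables and
  multiplies the number of products by at most \<open>kinds_bound\<close>.\<close>

lemma between_poly_expansion:
  assumes "1 \<le> r" and "1 \<le> kinds_bound"
    and "walks s u \<noteq> {}" and "walks u t \<noteq> {}"
    and "card (between_vars u t) < (k + 1) * (r + 1)"
  shows "\<exists>Qss. product_sum r k (between_vars u t) Qss \<and>
    products_poly Qss = between_poly u t \<and> length Qss \<le> kinds_bound ^ k"
  using assms(3-5)
proof (induction k arbitrary: u)
  \<comment> \<open>With at most r variables left, a single product with a single factor suffices,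
    for any k; its length 1 is within the bound as \<open>kinds_bound\<close> is at least 1.\<close>
  have small: "\<exists>Qss. product_sum r k (between_vars u t) Qss \<and>
      products_poly Qss = between_poly u t \<and> length Qss \<le> kinds_bound ^ k"
    if u: "walks s u \<noteq> {}" "walks u t \<noteq> {}" and card: "card (between_vars u t) \<le> r" for u k
  proof -
    obtain Q where "factor r (between_vars u t) Q" "formula_poly Q = between_poly u t"
      using between_poly_small[OF u(1) walks_target[OF u(2)] card] by blast
    then show ?thesis
      using assms(2) by (intro exI[of _ "[[Q]]"]) (simp add: product_sum_def products_poly_def)
  qed
  {
    case 0
    then show ?case
      using small[of u 0] by simp
  next
    case (Suc k)
    show ?case
    proof (cases "card (between_vars u t) \<le> r")
      case True
      then show ?thesis
        using small Suc.prems by blast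
    next
      case False
      let ?C = "crossing_arcs r u t"
      let ?B = "\<lambda>\<kappa>. \<Sum>e\<in>{e \<in> ?C. arc_kind e = \<kappa>}. atom_poly (lab e)"
      let ?p = "\<lambda>(v, w, V). between_poly u v * ?B (v, w, V) * between_poly w t"
      have "u \<in> verts G"
        using Suc.prems(2) by (auto simp: walks_def)
      have "\<exists>Qss. product_sum r (Suc k) (between_vars u t) Qss \<and>
          products_poly Qss = ?p \<kappa> \<and> length Qss \<le> kinds_bound ^ k" if \<kappa>: "\<kappa> \<in> arc_kind ` ?C" for \<kappa>
      proof -
        obtain v w V where vwV: "\<kappa> = (v, w, V)"
          by (metis surj_pair)
        then obtain e where e: "e \<in> ?C" "tail G e = v" "head G e = w" "atom_vars (lab e) = V"
          using \<kappa> by (auto simp: arc_kind_def)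
        have "walks s w \<noteq> {}"
          using e walks_trans[OF walks_trans[OF Suc.prems(1)] walks_arc[of e]]
          by (auto simp: crossing_arcs_def)
        moreover have "walks w t \<noteq> {}"
          using e by (auto simp: crossing_arcs_def)
        \<comment> \<open>Subtracting r + 1 from the bound (k + 2) (r + 1) for u leaves exactly the
          bound for k.\<close>
        moreover have "card (between_vars w t) < (k + 1) * (r + 1)"
          using card_between_vars_after_crossing[OF Suc.prems(1) e(1)] Suc.prems(3) e(3) by simp
        ultimately obtain Qss where Qss: "product_sum r k (between_vars w t) Qss"
          "products_poly Qss = between_poly w t" "length Qss \<le> kinds_bound ^ k"
          using Suc.IH by blast
        have "squarefree_over V (?B (v, w, V))"
          using squarefree_atom_poly by (intro squarefree_over_sum) (auto simp: arc_kind_def)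
        from crossing_arc_expansion[OF assms(1) Suc.prems(1) e this Qss(1,2)]
        obtain Qss' where "product_sum r (Suc k) (between_vars u t) Qss'"
          "products_poly Qss' = ?p \<kappa>" "length Qss' = length Qss"
          unfolding vwV prod.case .
        then show ?thesis
          using Qss(3) by (intro exI[of _ Qss'] conjI) simp_all
      qed
      then have "\<forall>\<kappa>\<in>arc_kind ` ?C. \<exists>Qss. product_sum r (Suc k) (between_vars u t) Qss \<and>
          products_poly Qss = ?p \<kappa> \<and> length Qss \<le> kinds_bound ^ k" ..
      from bchoice[OF this] obtain E where "\<forall>\<kappa>\<in>arc_kind ` ?C.
          product_sum r (Suc k) (between_vars u t) (E \<kappa>) \<and>
          products_poly (E \<kappa>) = ?p \<kappa> \<and> length (E \<kappa>) \<le> kinds_bound ^ k" ..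
      note E = bspec[OF this]
      obtain ks where ks: "set ks = arc_kind ` ?C" "distinct ks"
        using finite_distinct_list[OF finite_imageI[OF finite_crossing_arcs]] by metis
      let ?Qss = "concat (map E ks)"
      have "product_sum r (Suc k) (between_vars u t) ?Qss"
        by (rule product_sum_concat) (use E ks(1) in auto)
      moreover have "products_poly ?Qss = between_poly u t"
      proof -
        have "products_poly ?Qss = (\<Sum>\<kappa>\<in>arc_kind ` ?C. products_poly (E \<kappa>))"
          using ks by (simp add: products_poly_concat o_def sum_list_distinct_conv_sum_set)
        also have "\<dots> = (\<Sum>\<kappa>\<in>arc_kind ` ?C. ?p \<kappa>)"
          by (rule sum.cong) (use E in auto)
        also have "\<dots> = between_poly u t"
          using False
          by (intro between_poly_crossing_kinds[OF \<open>u \<in> verts G\<close>, symmetric]) simp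
        finally show ?thesis .
      qed
      moreover have "length ?Qss \<le> kinds_bound ^ Suc k"
      proof -
        have "length ?Qss = (\<Sum>\<kappa>\<leftarrow>ks. length (E \<kappa>))"
          by (simp add: length_concat o_def)
        also have "\<dots> \<le> (\<Sum>\<kappa>\<leftarrow>ks. kinds_bound ^ k)"
          using E ks(1) by (intro sum_list_mono) auto
        also have "\<dots> = card (arc_kind ` ?C) * kinds_bound ^ k"
          using distinct_card[OF ks(2)] ks(1) by (simp add: sum_list_triv)
        also have "\<dots> \<le> kinds_bound * kinds_bound ^ k"
          by (intro mult_right_mono card_arc_kinds) (auto simp: crossing_arcs_def)
        finally show ?thesis by simp
      qed
      ultimately show ?thesis by blast
    qed
  }
qed

end

section \<open>The size bound\<close>

lemma product_sum_sps_formula: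
  fixes Qss :: "'a::comm_ring_1 formula list list"
  assumes "product_sum r k V Qss" and "V \<subseteq> {1..n}" and "1 \<le> n"
    and "real r \<le> sqrt (real n)" and "real k \<le> sqrt (real n)"
  shows "sps_formula 20 n (Plus (map Times Qss))"
    and "formula_syntactic_multilinear (Plus (map Times Qss))"
    and "formula_poly (Plus (map Times Qss)) = products_poly Qss"
proof -
  have sq: "1 \<le> sqrt (real n)"
    using assms(3) by simp
  have Qs: "real (length Qs) \<le> 20 * sqrt (real n)" if "Qs \<in> set Qss" for Qs
  proof -
    have "length Qs \<le> 2 * k + 1"
      using assms(1) that unfolding product_sum_def by blast
    then have "real (length Qs) \<le> 2 * real k + 1"
      by linarith
    \<comment> \<open>Since sqrt n is at least 1, 2 k + 1 is at most 3 sqrt n; the constant 20 is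
      generous.\<close>
    then show ?thesis
      using sq assms(5) by linarith
  qed
  have Q: "factor r V Q" if "Qs \<in> set Qss" "Q \<in> set Qs" for Qs Q
    using assms(1) that unfolding product_sum_def by blast
  have "real (card (formula_vars Q)) \<le> 20 * sqrt (real n)" if "Qs \<in> set Qss" "Q \<in> set Qs" for Qs Q
  proof -
    have "real (card (formula_vars Q)) \<le> real r"
      using Q[OF that] by (simp add: factor_def)
    then show ?thesis
      using sq assms(4) by linarith
  qed
  moreover have "formula_vars (Plus (map Times Qss)) \<subseteq> {1..n}"
    using Q assms(2) by (fastforce simp: factor_def)
  moreover have "sum_of_monomials Q \<and> multilinear (formula_poly Q)"
    if "Qs \<in> set Qss" "Q \<in> set Qs" for Qs Q
    using Q[OF that] by (simp add: factor_def)
  ultimately show "sps_formula 20 n (Plus (map Times Qss))"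
    unfolding sps_formula_def using Qs by (intro conjI exI[of _ Qss] ballI) simp_all
  show "formula_syntactic_multilinear (Plus (map Times Qss))"
    using assms(1) by (auto simp: product_sum_def factor_def)
  show "formula_poly (Plus (map Times Qss)) = products_poly Qss"
    by (simp add: products_poly_def o_def)
qed

lemma product_sum_size_le_power:
  fixes N r :: nat
  assumes "1 \<le> N" and "1 \<le> r"
  shows "1 + N * (1 + (2 * r + 1) * (1 + 2 ^ r * (r + 2))) \<le> N * (2 ^ 8) ^ r"
proof -
  define x :: nat where "x = 2 ^ r"
  have x: "r + 1 \<le> x" "2 \<le> x"
    using less_exp[of r] assms(2) unfolding x_def by linarith+
  \<comment> \<open>Every added 1 costs one further power of x. The factor size is at most x^4 and
    the fan-in at most x^2; the two product gate and top gate terms raise x^6 to x^7 and then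
    x^8.\<close>
  have step: "1 + x ^ i \<le> x ^ Suc i" for i
  proof -
    have "1 \<le> x ^ i" using x(2) by simp
    moreover have "2 * x ^ i \<le> x * x ^ i" using x(2) by (rule mult_right_mono) simp
    ultimately show ?thesis unfolding power_Suc by linarith
  qed
  have "x * (r + 2) \<le> x * (x * x)"
  proof (rule mult_left_mono)
    have "r + 2 \<le> 2 * x" using x by simp
    also have "\<dots> \<le> x * x" using x(2) by (rule mult_right_mono) simp
    finally show "r + 2 \<le> x * x" .
  qed simp
  then have "1 + x * (r + 2) \<le> x ^ 4"
    using step[of 3] by (simp add: eval_nat_numeral)
  moreover have "2 * r + 1 \<le> x ^ 2"
  proof -
    have "2 * r + 1 \<le> 2 * x" using x by simp
    also have "\<dots> \<le> x * x" using x(2) by (rule mult_right_mono) simp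
    finally show ?thesis by (simp add: power2_eq_square)
  qed
  ultimately have "(2 * r + 1) * (1 + x * (r + 2)) \<le> x ^ 2 * x ^ 4"
    by (intro mult_mono) auto
  then have "1 + (2 * r + 1) * (1 + x * (r + 2)) \<le> x ^ 7"
    using step[of 6] by (simp flip: power_add)
  then have "1 + N * (1 + (2 * r + 1) * (1 + x * (r + 2))) \<le> N + N * x ^ 7"
    using assms(1) by (intro add_mono mult_left_mono) auto
  also have "\<dots> = N * (1 + x ^ 7)"
    by simp
  also have "\<dots> \<le> N * x ^ 8"
    using step[of 7] by (intro mult_left_mono) auto
  also have "x ^ 8 = (2 ^ 8) ^ r"
    unfolding x_def by (simp only: mult.commute flip: power_mult)
  finally show ?thesis
    unfolding x_def .
qed

lemma size_bound:
  fixes n S r :: nat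
  assumes "2 \<le> n" and "2 \<le> S" and "real r \<le> sqrt (real n)"
  shows "real ((S ^ 2 * (n + 1)) ^ r * (2 ^ 8) ^ r)
    \<le> 2 powr (20 * max 1 (sqrt (real n) * log 2 (real n) * log 2 (real S)))"
proof -
  let ?a = "log 2 (real n)" and ?b = "log 2 (real S)"
  have ab: "1 \<le> ?a" "1 \<le> ?b"
    using assms by (simp_all add: le_log_iff)
  \<comment> \<open>From (a - 1) (b - 1) \<ge> 0 follows a + b \<le> a b + 1, and 1 \<le> a b. Hence
    2 b + 2 a + 8 is at most 4 a b + 8 a b.\<close>
  have "?a + ?b \<le> 2 * (?a * ?b)"
    using mult_nonneg_nonneg[of "?a - 1" "?b - 1"] mult_mono[of 1 ?a 1 ?b] ab
    by (simp add: algebra_simps)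
  then have exponent: "2 * ?b + 2 * ?a + 8 \<le> 12 * (?a * ?b)"
    using mult_mono[of 1 ?a 1 ?b] ab by simp
  have "n + 1 \<le> n ^ 2"
    using mult_right_mono[OF assms(1), of n] assms(1) unfolding power2_eq_square by linarith
  then have "real (n + 1) \<le> real (n ^ 2)"
    by (simp only: of_nat_le_iff)
  then have "real (S ^ 2 * (n + 1)) * 2 ^ 8 \<le> real S ^ 2 * real n ^ 2 * 2 ^ 8"
    unfolding of_nat_mult of_nat_power by (intro mult_left_mono mult_right_mono) simp_all
  also have "\<dots> = 2 powr (2 * ?b) * 2 powr (2 * ?a) * 2 powr 8"
  proof -
    have "2 powr (2 * log 2 (real m)) = real m ^ 2" if "2 \<le> m" for m
      unfolding mult_2 powr_add using that by (simp add: power2_eq_square)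
    moreover have "2 powr 8 = (2::real) ^ 8"
      by simp
    ultimately show ?thesis
      using assms by presburger
  qed
  also have "\<dots> = 2 powr (2 * ?b + 2 * ?a + 8)"
    by (simp only: powr_add)
  also have "\<dots> \<le> 2 powr (12 * (?a * ?b))"
    using exponent by simp
  finally have base: "real (S ^ 2 * (n + 1)) * 2 ^ 8 \<le> 2 powr (12 * (?a * ?b))" .
  have "real ((S ^ 2 * (n + 1)) ^ r * (2 ^ 8) ^ r) = (real (S ^ 2 * (n + 1)) * 2 ^ 8) ^ r"
    by (simp only: power_mult_distrib of_nat_mult of_nat_power of_nat_numeral)
  also have "\<dots> \<le> (2 powr (12 * (?a * ?b))) ^ r"
    by (rule power_mono[OF base]) simp
  also have "\<dots> = 2 powr (12 * (?a * ?b) * real r)"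
    by (simp add: powr_realpow[symmetric] powr_powr)
  also have "\<dots> \<le> 2 powr (20 * max 1 (sqrt (real n) * ?a * ?b))"
  proof -
    have "12 * (?a * ?b) * real r \<le> 12 * (?a * ?b) * sqrt (real n)"
      using assms(3) ab by (intro mult_left_mono) auto
    also have "\<dots> = 12 * (sqrt (real n) * ?a * ?b)"
      by (simp add: mult_ac)
    also have "\<dots> \<le> 20 * max 1 (sqrt (real n) * ?a * ?b)"
      by linarith
    finally show ?thesis by simp
  qed
  finally show ?thesis .
qed

context multilinear_program
begin

lemma between_poly_formula:
  assumes "walks s t \<noteq> {}" and "1 \<le> n" and S: "card (verts G) = S" "2 \<le> S"
  shows "\<exists>F. sps_formula 20 n F \<and> formula_syntactic_multilinear F \<and>
    formula_poly F = between_poly s t \<and>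
    real (formula_size F) \<le> 2 powr (20 * max 1 (sqrt (real n) * log 2 (real n) * log 2 (real S)))"
proof -
  define r where "r = nat \<lfloor>sqrt (real n)\<rfloor>"
  have sq: "1 \<le> sqrt (real n)"
    using assms(2) by simp
  have r: "1 \<le> r" "real r \<le> sqrt (real n)" "sqrt (real n) < real (r + 1)"
    unfolding r_def using sq by linarith+
  \<comment> \<open>There are at most n variables, so this permits the expansion with k = r
    crossings.\<close>
  have "n < (r + 1) * (r + 1)"
  proof -
    have "sqrt (real n) * sqrt (real n) < real (r + 1) * real (r + 1)"
      using r(3) sq by (intro mult_strict_mono) auto
    then have "real n < real ((r + 1) * (r + 1))"
      by (simp only: of_nat_mult real_sqrt_mult_self abs_of_nat)
    then show ?thesis by (simp only: of_nat_less_iff)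
  qed
  moreover have card: "card (between_vars s t) \<le> n"
    using card_mono[OF _ between_vars_bound[of s t]] by simp
  ultimately have lt: "card (between_vars s t) < (r + 1) * (r + 1)"
    by simp
  have kb: "kinds_bound = S ^ 2 * (n + 1)" "1 \<le> kinds_bound"
    using S by (auto simp: kinds_bound_def Suc_le_eq simp del: mult_Suc_right)
  have "s \<in> verts G"
    using assms(1) by (auto simp: walks_def)
  then have ss: "walks s s \<noteq> {}"
    by (simp add: walks_refl)
  show ?thesis
  proof (cases "n = 1")
    \<comment> \<open>For n = 1 the logarithm of n vanishes and only the constant bound 2^20
      remains. At most one variable occurs and r = 1, so k = 0 suffices and the size is at most
      9.\<close>
    case True
    then have "card (between_vars s t) < (0 + 1) * (r + 1)"
      using card r(1) by simp
    from between_poly_expansion[OF r(1) kb(2) ss assms(1) this]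
    obtain Qss where Qss: "product_sum r 0 (between_vars s t) Qss"
      "products_poly Qss = between_poly s t" "length Qss \<le> 1"
      by auto
    have "r = 1"
      by (simp add: r_def True)
    then have "formula_size (Plus (map Times Qss)) \<le> 1 + length Qss * 8"
      using formula_size_product_sum[OF Qss(1)] by simp
    then have "real (formula_size (Plus (map Times Qss))) \<le> 9"
      using Qss(3) by linarith
    also have "\<dots> \<le> 2 powr (20 * 1)"
      by simp
    also have "\<dots> \<le> 2 powr (20 * max 1 (sqrt (real n) * log 2 (real n) * log 2 (real S)))"
      by (intro powr_mono mult_left_mono) auto
    finally show ?thesis
      using product_sum_sps_formula[OF Qss(1) between_vars_bound assms(2) r(2)] Qss(2) sq by auto
  next
    case False
    obtain Qss where Qss: "product_sum r r (between_vars s t) Qss"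
      "products_poly Qss = between_poly s t" "length Qss \<le> kinds_bound ^ r"
      using between_poly_expansion[OF r(1) kb(2) ss assms(1) lt] by blast
    have "formula_size (Plus (map Times Qss))
        \<le> 1 + length Qss * (1 + (2 * r + 1) * (1 + 2 ^ r * (r + 2)))"
      by (rule formula_size_product_sum[OF Qss(1)])
    also have "\<dots> \<le> 1 + kinds_bound ^ r * (1 + (2 * r + 1) * (1 + 2 ^ r * (r + 2)))"
      by (intro add_left_mono mult_right_mono Qss(3)) simp
    also have "\<dots> \<le> kinds_bound ^ r * (2 ^ 8) ^ r"
      using kb(2) by (intro product_sum_size_le_power r(1)) simp
    finally have "real (formula_size (Plus (map Times Qss)))
        \<le> real ((S ^ 2 * (n + 1)) ^ r * (2 ^ 8) ^ r)"
      unfolding kb(1) by (simp only: of_nat_le_iff)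
    also have "\<dots> \<le> 2 powr (20 * max 1 (sqrt (real n) * log 2 (real n) * log 2 (real S)))"
      using False assms(2) S(2) r(2) by (intro size_bound) auto
    finally show ?thesis
      using product_sum_sps_formula[OF Qss(1) between_vars_bound assms(2) r(2) r(2)] Qss(2) by auto
  qed
qed

end

section \<open>From branching programs to layered digraphs\<close>

lemma layer_function_exists:
  assumes "disjoint_family_on L {..l}"
  obtains layer :: "'v \<Rightarrow> nat" where "\<And>v i. v \<in> L i \<Longrightarrow> i \<le> l \<Longrightarrow> layer v = i"
proof
  fix v i assume "v \<in> L i" "i \<le> l"
  then show "(THE j. j \<le> l \<and> v \<in> L j) = i"
    using assms unfolding disjoint_family_on_def by (intro the_equality) auto
qed

theorem corollary1:
  fixes P :: "('v, 'e, 'a::field) abp" and f :: "'a mpoly" and n S :: nat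
  assumes "n \<ge> 1"
    and "is_abp n P"
    and "abp_syntactic_multilinear P"
    and "abp_size P = S"
    and "abp_poly P = f"
  shows "\<exists>F :: 'a formula.
    sps_formula 20 n F \<and>
    formula_syntactic_multilinear F \<and>
    formula_poly F = f \<and>
    real (formula_size F)
      \<le> 2 powr (20 * max 1 (sqrt (real n) * log 2 (real n) * log 2 (real S)))"
proof -
  let ?bound = "2 powr (20 * max 1 (sqrt (real n) * log 2 (real n) * log 2 (real S)))"
  \<comment> \<open>Enough for the two degenerate cases, whose formulas have sizes 1 and 2.\<close>
  have bound: "2 \<le> ?bound"
  proof -
    have "(2::real) \<le> 2 powr (20 * 1)"
      by simp
    also have "\<dots> \<le> ?bound"
      by (intro powr_mono mult_left_mono) auto
    finally show ?thesis .
  qed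
  have fin: "fin_digraph (graph P)"
    and vars: "\<And>e. e \<in> arcs (graph P) \<Longrightarrow> atom_vars (label P e) \<subseteq> {1..n}"
    using assms(2) by (simp_all add: is_abp_def)
  obtain l L where L: "verts (graph P) = (\<Union>i\<le>l. L i)" "disjoint_family_on L {..l}"
      "L 0 = {source P}" "L l = {sink P}"
    and arc: "\<forall>e\<in>arcs (graph P).
      \<exists>i<l. tail (graph P) e \<in> L i \<and> head (graph P) e \<in> L (Suc i)"
    using assms(2) unfolding is_abp_def by (elim conjE exE) (rule that)
  obtain layer where layer: "\<And>v i. v \<in> L i \<Longrightarrow> i \<le> l \<Longrightarrow> layer v = i"
    using layer_function_exists[OF L(2)] by blast
  interpret fin_digraph "graph P"
    by (rule fin)
  interpret layered_digraph "graph P" layer "label P"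
  proof
    fix e assume "e \<in> arcs (graph P)"
    then obtain i where "i < l" "tail (graph P) e \<in> L i" "head (graph P) e \<in> L (Suc i)"
      using arc by blast
    then show "layer (head (graph P) e) = Suc (layer (tail (graph P) e))"
      using layer[of _ i] layer[of _ "Suc i"] by simp
  qed
  have paths: "abp_paths P = walks (source P) (sink P)"
    unfolding abp_paths_def walks_def using awalk_imp_apath awalkI_apath by blast
  have f: "f = between_poly (source P) (sink P)"
    using assms(5) unfolding abp_poly_def between_poly_def walk_poly_def paths by simp
  interpret multilinear_program "graph P" layer "label P" "source P" "sink P" n
  proof
    fix p i assume "awalk (source P) p (sink P)"
    then show "count_list (map (label P) p) (Variable i) \<le> 1"
      using assms(3) paths unfolding abp_syntactic_multilinear_def walks_def by blast
  qed (rule vars)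
  have st: "source P \<in> verts (graph P)" "sink P \<in> verts (graph P)"
    using L by auto
  have S: "card (verts (graph P)) = S"
    using assms(4) by (simp add: abp_size_def)
  have "card (verts (graph P)) \<noteq> 0"
    using st(1) by auto
  then have "1 \<le> S"
    using S by simp
  then consider "walks (source P) (sink P) = {}" | "S = 1" |
    "walks (source P) (sink P) \<noteq> {}" "2 \<le> S"
    by linarith
  then show ?thesis
  proof cases
    \<comment> \<open>The polynomial is an empty sum, that is 0, computed by the empty
      \<open>Plus\<close>.\<close>
    case 1
    then have "formula_poly (Plus []) = f"
      by (simp add: f between_poly_def)
    then show ?thesis
      using bound by (intro exI[of _ "Plus []"]) (auto simp: sps_formula_def)
  next
    \<comment> \<open>Source and sink coincide, so the only walk is empty and the polynomial is 1,
      computed by an empty product.\<close>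
    case 2
    then have "sink P = source P"
      using S st by (metis card_1_singletonE singletonD)
    then have "formula_poly (Plus [Times []]) = f"
      using st by (simp add: f between_poly_def walks_refl walk_poly_def)
    moreover have "sps_formula 20 n (Plus [Times [] :: 'a formula])"
      unfolding sps_formula_def by (auto intro!: exI[of _ "[[]]"])
    ultimately show ?thesis
      using bound by (intro exI[of _ "Plus [Times []]"]) auto
  next
    case 3
    then show ?thesis
      using between_poly_formula[OF _ assms(1) S] f by simp
  qed
qed

end
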